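(* Let $R$ be a commutative Noetherian ring with non-zero identity, $I$ an ideal of $R$, and $E$ a non-zero finitely generated $R$-module. Let $m$ and $n$ be two natural numbers such that $n\geq m$. Then $$\bigl(\widetilde{I^n_E} :_E \widetilde{I^m}\bigr) = \bigl(\widetilde{I^n_E}:_E I^m\bigr) =\widetilde{I^{n-m}_E}.$$
   Context: For an ideal $J$ of a commutative ring $R$ and an $R$-module $E$, the Ratliff-Rush closure of $J$ with respect to $E$ is the submodule $$\widetilde{J_E}=\bigcup_{k\in\mathbb{N}}(J^{k+1}E:_E J^k)=\{e\in E : J^k e\subseteq J^{k+1}E\text{ for some }k\in\mathbb{N}\}$$ of $E$. $\widetilde{I^n_E}$ denotes the Ratliff-Rush closure of the ideal $I^n$ with respect to $E$ (with $I^0=R$), and $\widetilde{I^m}$ denotes the Ratliff-Rush closure of the ideal $I^m$ with respect to the module $R$, i.e. $\widetilde{J}=\bigcup_{k\ge1}(J^{k+1}:_R J^k)$ with $J=I^m$. For a submodule $N\subseteq E$ and an ideal $J$ of $R$, $(N:_E J)=\{e\in E: Je\subseteq N\}$. *)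

theory Defs
  imports "HOL-Algebra.Algebra"
begin

definition submodule_span ::
    "('a, 'c) ring_scheme \<Rightarrow> ('a, 'b, 'd) module_scheme \<Rightarrow> 'b set \<Rightarrow> 'b set"
  where "submodule_span R E A = \<Inter> {N. submodule N R E \<and> A \<subseteq> N}"

definition fin_gen_module ::
    "('a, 'c) ring_scheme \<Rightarrow> ('a, 'b, 'd) module_scheme \<Rightarrow> bool"
  where "fin_gen_module R E \<longleftrightarrow>
    (\<exists>A \<subseteq> carrier E. finite A \<and> carrier E = submodule_span R E A)"

abbreviation ideal_power :: "('a, 'c) ring_scheme \<Rightarrow> 'a set \<Rightarrow> nat \<Rightarrow> 'a set"
  where "ideal_power R J k \<equiv> J [^]\<^bsub>ideals_set R\<^esub> k"

text \<open>The submodule \<open>J E\<close>, consisting of the finite sums of elements \<open>a x\<close>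
  with \<open>a\<close> in \<open>J\<close> and \<open>x\<close> in \<open>E\<close>.\<close>

definition ideal_smult ::
    "('a, 'c) ring_scheme \<Rightarrow> ('a, 'b, 'd) module_scheme \<Rightarrow> 'a set \<Rightarrow> 'b set"
  where "ideal_smult R E J = submodule_span R E {a \<odot>\<^bsub>E\<^esub> x | a x. a \<in> J \<and> x \<in> carrier E}"

text \<open>\<open>module_colon E N J\<close> is \<open>(N :\<^sub>E J)\<close>.\<close>

definition module_colon ::
    "('a, 'b, 'd) module_scheme \<Rightarrow> 'b set \<Rightarrow> 'a set \<Rightarrow> 'b set"
  where "module_colon E N J = {e \<in> carrier E. \<forall>a \<in> J. a \<odot>\<^bsub>E\<^esub> e \<in> N}"

text \<open>The union is over all natural numbers, including \<open>0\<close>; the lemma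
  \<open>ratliff_rush_from_one\<close> below shows that starting at \<open>1\<close> gives the same set.\<close>

definition ratliff_rush ::
    "('a, 'c) ring_scheme \<Rightarrow> ('a, 'b, 'd) module_scheme \<Rightarrow> 'a set \<Rightarrow> 'b set"
  where "ratliff_rush R E J =
    (\<Union>k. module_colon E (ideal_smult R E (ideal_power R J (k + 1))) (ideal_power R J k))"

text \<open>\<open>R\<close> as a module over itself.\<close>

definition regular_module :: "('a, 'c) ring_scheme \<Rightarrow> ('a, 'a) module"
  where "regular_module R =
    \<lparr>carrier = carrier R, monoid.mult = monoid.mult R, one = one R, ring.zero = ring.zero R, add = add R, smult = monoid.mult R\<rparr>"

definition ratliff_rush_ideal :: "('a, 'c) ring_scheme \<Rightarrow> 'a set \<Rightarrow> 'a set"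
  where "ratliff_rush_ideal R J = ratliff_rush R (regular_module R) J"

lemma (in cring) regular_module_is_module: "module R (regular_module R)"
proof (rule moduleI)
  show "cring R" by (rule is_cring)
  show "abelian_group (regular_module R)"
    by (rule abelian_groupI) (auto simp: regular_module_def a_ac intro: l_neg)
qed (auto simp: regular_module_def l_distr r_distr m_assoc)

lemma (in module) submodule_span_submodule:
  assumes "A \<subseteq> carrier M"
  shows "submodule (submodule_span R M A) R M"
proof (rule submoduleI)
  show "submodule_span R M A \<subseteq> carrier M"
    using assms carrier_is_submodule by (auto simp: submodule_span_def)
  show "\<zero>\<^bsub>M\<^esub> \<in> submodule_span R M A"
    using subgroup.one_closed[OF submodule.axioms(1)] by (fastforce simp: submodule_span_def)
qed (auto simp: submodule_span_def dest: submoduleE)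

lemma ratliff_rush_from_one:
  assumes "module R E" "ideal J R"
  shows "ratliff_rush R E J =
    (\<Union>k\<in>{1..}. module_colon E (ideal_smult R E (ideal_power R J (k + 1))) (ideal_power R J k))"
proof -
  interpret module R E by fact
  interpret J: ideal J R by fact
  let ?S = "\<lambda>K. {a \<odot>\<^bsub>E\<^esub> x | a x. a \<in> K \<and> x \<in> carrier E}"
  let ?C = "\<lambda>k::nat. module_colon E (ideal_smult R E (ideal_power R J (k + 1))) (ideal_power R J k)"
  have one: "ideal_power R J 1 = J"
    using monoid.nat_pow_eone[of "ideals_set R" J] ideals_set_is_comm_monoid assms(2)
    by (auto simp: comm_monoid_def ideals_set_def)
  have two: "ideal_power R J 2 = J \<cdot>\<^bsub>R\<^esub> J"
    using one by (simp add: numeral_2_eq_2 ideals_set_def)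
  have J2: "ideal (J \<cdot>\<^bsub>R\<^esub> J) R"
    by (rule ideal_prod_is_ideal) (rule assms)+
  have "?S (J \<cdot>\<^bsub>R\<^esub> J) \<subseteq> carrier E"
    using ideal.Icarr[OF J2] by auto
  then have N: "submodule (ideal_smult R E (J \<cdot>\<^bsub>R\<^esub> J)) R E" (is "submodule ?N _ _")
    unfolding ideal_smult_def by (rule submodule_span_submodule)
  note NE = submoduleE[OF N]
  have zeroN: "\<zero>\<^bsub>E\<^esub> \<in> ?N"
    using subgroup.one_closed[OF submodule.axioms(1)[OF N]] by simp
  have gen: "a \<odot>\<^bsub>E\<^esub> x \<in> ?N" if "a \<in> J \<cdot>\<^bsub>R\<^esub> J" "x \<in> carrier E" for a x
    using that by (auto simp: ideal_smult_def submodule_span_def)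
  have C: "submodule (module_colon E ?N J) R E"
  proof (rule submoduleI)
    fix a x assume ax: "a \<in> carrier R" "x \<in> module_colon E ?N J"
    have "b \<odot>\<^bsub>E\<^esub> (a \<odot>\<^bsub>E\<^esub> x) \<in> ?N" if b: "b \<in> J" for b
    proof -
      have "b \<odot>\<^bsub>E\<^esub> (a \<odot>\<^bsub>E\<^esub> x) = a \<odot>\<^bsub>E\<^esub> (b \<odot>\<^bsub>E\<^esub> x)"
        using ax b by (simp add: module_colon_def smult_assoc1[symmetric] R.m_comm)
      then show ?thesis
        using ax b NE(4) by (auto simp: module_colon_def)
    qed
    then show "a \<odot>\<^bsub>E\<^esub> x \<in> module_colon E ?N J"
      using ax by (auto simp: module_colon_def)
  qed (use zeroN NE in \<open>auto simp: module_colon_def smult_r_minus smult_r_distr\<close>)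
  have "?S J \<subseteq> module_colon E ?N J"
  proof clarify
    fix a x assume ax: "a \<in> J" "x \<in> carrier E"
    have "b \<odot>\<^bsub>E\<^esub> (a \<odot>\<^bsub>E\<^esub> x) \<in> ?N" if b: "b \<in> J" for b
      using gen[OF ideal_prod.prod[OF b ax(1)] ax(2)] ax b by (simp add: smult_assoc1)
    then show "a \<odot>\<^bsub>E\<^esub> x \<in> module_colon E ?N J"
      using ax by (simp add: module_colon_def)
  qed
  then have sub: "ideal_smult R E J \<subseteq> module_colon E ?N J"
    using C by (auto simp: ideal_smult_def[of R E J] submodule_span_def[of R E "?S J"])
  have "?C 0 \<subseteq> ?C 1"
  proof
    fix x assume x: "x \<in> ?C 0"
    then have xE: "x \<in> carrier E" and "\<forall>a\<in>carrier R. a \<odot>\<^bsub>E\<^esub> x \<in> ideal_smult R E J"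
      using one by (auto simp: module_colon_def ideals_set_def)
    then have "x \<in> ideal_smult R E J"
      using smult_one[OF xE] by (metis R.one_closed)
    then show "x \<in> ?C 1"
      using sub one two by (auto simp: numeral_2_eq_2)
  qed
  then have "?C k \<subseteq> (\<Union>k\<in>{1..}. ?C k)" for k
    by (cases "k = 0") (force, (rule UN_upper, simp))
  then show ?thesis
    unfolding ratliff_rush_def by blast
qed

end

theory Submission
  imports Defs
begin

text \<open>
  Write \<open>M\<close> for the module and \<open>C k t = (I\<^sup>k\<^sup>+\<^sup>t M : I\<^sup>k)\<close> for what is called
  \<open>power_colon I k t\<close> below; an element of it will be said to gain \<open>t\<close>. For fixed \<open>t\<close> the
  submodules \<open>C k t\<close> grow with \<open>k\<close>, and their union is the Ratliff-Rush closure of \<open>I\<^sup>t\<close> with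
  respect to \<open>M\<close> (\<open>ratliff_rush_ideal_power\<close>): the definition of the closure only runs
  through the exponents \<open>k\<close> that are multiples of \<open>t\<close>, but for \<open>t > 0\<close> these are cofinal.
  In this form closures of different powers of \<open>I\<close> can be compared, since the exponent \<open>k\<close>
  is free and only the gain \<open>t\<close> matters.

  The claim is now an exercise in bookkeeping of exponents. An element \<open>a\<close> of the closure
  of \<open>I\<^sup>m\<close> in \<open>R\<close> gains \<open>m\<close>, an element \<open>e\<close> of the closure of \<open>I\<^sup>n\<^sup>-\<^sup>m\<close> in \<open>M\<close> gains \<open>n - m\<close>,
  and gains add up, so \<open>a e\<close> gains \<open>n\<close> (\<open>ratliff_rush_smult\<close>). As \<open>I\<^sup>m\<close> lies in
  its own closure, this yields
  \<open>closure (I\<^sup>n\<^sup>-\<^sup>m) \<subseteq> (closure (I\<^sup>n) : closure (I\<^sup>m)) \<subseteq> (closure (I\<^sup>n) : I\<^sup>m)\<close>.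
  The circle is closed by finite generation of \<open>I\<^sup>m\<close>: if \<open>I\<^sup>m e\<close> lies in the increasing union
  of the \<open>C k n\<close>, it lies in a single \<open>C k n\<close>, so that \<open>I\<^sup>k\<^sup>+\<^sup>m e \<subseteq> I\<^sup>k\<^sup>+\<^sup>n M\<close>. This says that
  \<open>e\<close> gains \<open>n - m\<close> at the exponent \<open>k + m\<close> (\<open>colon_ratliff_rush_subset\<close>).
\<close>

section \<open>Powers of an ideal\<close>

context cring
begin

lemma ideal_power_is_ideal:
  assumes "ideal I R"
  shows "ideal (ideal_power R I k) R"
  using monoid.nat_pow_closed[of "ideals_set R" I k] ideals_set_is_comm_monoid assms
  by (auto simp: comm_monoid_def ideals_set_def)

lemma ideal_power_0: "ideal_power R I 0 = carrier R"
  by (simp add: ideals_set_def)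

lemma ideal_power_add:
  assumes "ideal I R"
  shows "ideal_power R I (j + k) = ideal_power R I j \<cdot> ideal_power R I k"
  using monoid.nat_pow_mult[of "ideals_set R" I j k] ideals_set_is_comm_monoid assms
  by (auto simp: comm_monoid_def ideals_set_def)

lemma ideal_power_power:
  assumes "ideal I R"
  shows "ideal_power R (ideal_power R I j) k = ideal_power R I (j * k)"
  using monoid.nat_pow_pow[of "ideals_set R" I j k] ideals_set_is_comm_monoid assms
  by (auto simp: comm_monoid_def ideals_set_def)

end


section \<open>The submodule \<open>J M\<close> and colon submodules\<close>

context module
begin

lemma ideal_smult_submodule:
  assumes "ideal J R"
  shows "submodule (ideal_smult R M J) R M"
  unfolding ideal_smult_def
  by (rule submodule_span_submodule) (use ideal.Icarr[OF assms] in auto)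

lemma smult_in_ideal_smult:
  assumes "a \<in> J" "x \<in> carrier M"
  shows "a \<odot>\<^bsub>M\<^esub> x \<in> ideal_smult R M J"
  using assms by (auto simp: ideal_smult_def submodule_span_def)

lemma ideal_smult_minimal:
  assumes "submodule N R M" "\<And>a x. a \<in> J \<Longrightarrow> x \<in> carrier M \<Longrightarrow> a \<odot>\<^bsub>M\<^esub> x \<in> N"
  shows "ideal_smult R M J \<subseteq> N"
  using assms by (auto simp: ideal_smult_def submodule_span_def)

lemma zero_in_submodule:
  assumes "submodule N R M"
  shows "\<zero>\<^bsub>M\<^esub> \<in> N"
  using subgroup.one_closed[OF submodule.axioms(1)[OF assms]] by simp

lemma module_colon_submodule:
  assumes "submodule N R M" "ideal J R"
  shows "submodule (module_colon M N J) R M"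
proof (rule submoduleI)
  note N = submoduleE[OF assms(1)]
  note J = ideal.Icarr[OF assms(2)]
  show "\<zero>\<^bsub>M\<^esub> \<in> module_colon M N J"
    using zero_in_submodule[OF assms(1)] J by (auto simp: module_colon_def)
  show "\<ominus>\<^bsub>M\<^esub> x \<in> module_colon M N J" if "x \<in> module_colon M N J" for x
    using that N(3) J by (auto simp: module_colon_def smult_r_minus)
  show "x \<oplus>\<^bsub>M\<^esub> y \<in> module_colon M N J"
    if "x \<in> module_colon M N J" "y \<in> module_colon M N J" for x y
    using that N(5) J by (auto simp: module_colon_def smult_r_distr)
  fix a x assume ax: "a \<in> carrier R" "x \<in> module_colon M N J"
  have "b \<odot>\<^bsub>M\<^esub> (a \<odot>\<^bsub>M\<^esub> x) \<in> N" if b: "b \<in> J" for b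
  proof -
    have "b \<odot>\<^bsub>M\<^esub> (a \<odot>\<^bsub>M\<^esub> x) = a \<odot>\<^bsub>M\<^esub> (b \<odot>\<^bsub>M\<^esub> x)"
      using ax J[OF b] by (simp add: module_colon_def smult_assoc1[symmetric] R.m_comm)
    then show ?thesis
      using ax b N(4) by (auto simp: module_colon_def)
  qed
  then show "a \<odot>\<^bsub>M\<^esub> x \<in> module_colon M N J"
    using ax by (auto simp: module_colon_def)
qed (auto simp: module_colon_def)

lemma module_colon_mono: "N \<subseteq> N' \<Longrightarrow> module_colon M N J \<subseteq> module_colon M N' J"
  by (auto simp: module_colon_def)

text \<open>This is what reduces membership in a colon submodule to a test on generators of the ideal.\<close>

lemma transporter_ideal:
  assumes N: "submodule N R M" and e: "e \<in> carrier M"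
  shows "ideal {a \<in> carrier R. a \<odot>\<^bsub>M\<^esub> e \<in> N} R" (is "ideal ?T R")
proof (rule idealI)
  note NE = submoduleE[OF N]
  show "subgroup ?T (add_monoid R)"
  proof (rule R.add.subgroupI)
    show "?T \<noteq> {}"
      using zero_in_submodule[OF N] e by auto
    show "\<ominus> a \<in> ?T" if "a \<in> ?T" for a
      using that NE(3) e by (auto simp: smult_l_minus)
    show "a \<oplus> b \<in> ?T" if "a \<in> ?T" "b \<in> ?T" for a b
      using that NE(5) e by (auto simp: smult_l_distr)
  qed auto
  show "x \<otimes> a \<in> ?T" if "a \<in> ?T" "x \<in> carrier R" for a x
    using that NE(4) e by (auto simp: smult_assoc1)
  then show "a \<otimes> x \<in> ?T" if "a \<in> ?T" "x \<in> carrier R" for a x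
    using that by (metis (no_types, lifting) R.m_comm mem_Collect_eq)
qed (rule R.ring_axioms)

lemma module_colon_genideal:
  assumes "submodule N R M" "A \<subseteq> carrier R"
  shows "module_colon M N (Idl A) = module_colon M N A"
proof
  show "module_colon M N (Idl A) \<subseteq> module_colon M N A"
    using R.genideal_self[OF assms(2)] by (auto simp: module_colon_def)
  show "module_colon M N A \<subseteq> module_colon M N (Idl A)"
  proof
    fix e assume e: "e \<in> module_colon M N A"
    then have eM: "e \<in> carrier M"
      by (simp add: module_colon_def)
    have "Idl A \<subseteq> {a \<in> carrier R. a \<odot>\<^bsub>M\<^esub> e \<in> N}"
      using e assms(2)
      by (intro R.genideal_minimal transporter_ideal[OF assms(1) eM])
        (auto simp: module_colon_def)
    then show "e \<in> module_colon M N (Idl A)"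
      using eM by (auto simp: module_colon_def)
  qed
qed

text \<open>The products \<open>a b\<close> generate \<open>J K\<close>, and on them the claim is \<open>(a b) e = b (a e)\<close>.\<close>

lemma module_colon_ideal_prod:
  assumes N: "submodule N R M" and J: "ideal J R" and K: "ideal K R"
  shows "module_colon M N (J \<cdot> K) = module_colon M (module_colon M N K) J"
proof -
  have JK: "J <#> K \<subseteq> carrier R"
    using ideal.Icarr[OF J] ideal.Icarr[OF K] by (auto simp: set_mult_def)
  have "module_colon M N (J <#> K) = module_colon M (module_colon M N K) J"
  proof -
    have "(a \<otimes> b) \<odot>\<^bsub>M\<^esub> e = b \<odot>\<^bsub>M\<^esub> (a \<odot>\<^bsub>M\<^esub> e)"
      if "a \<in> J" "b \<in> K" "e \<in> carrier M" for a b e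
      using that ideal.Icarr[OF J] ideal.Icarr[OF K]
      by (metis R.m_comm smult_assoc1)
    then show ?thesis
      using ideal.Icarr[OF J] by (fastforce simp: module_colon_def set_mult_def)
  qed
  then show ?thesis
    using module_colon_genideal[OF N JK] R.ideal_prod_eq_genideal[OF J K] by simp
qed

text \<open>One inclusion of \<open>J (K M) = (J K) M\<close>, phrased as a colon.\<close>

lemma ideal_smult_subset_colon:
  assumes J: "ideal J R" and K: "ideal K R"
  shows "ideal_smult R M K \<subseteq> module_colon M (ideal_smult R M (J \<cdot> K)) J"
proof (rule ideal_smult_minimal)
  show "submodule (module_colon M (ideal_smult R M (J \<cdot> K)) J) R M"
    by (intro module_colon_submodule ideal_smult_submodule R.ideal_prod_is_ideal J K)
  fix b x assume bx: "b \<in> K" "x \<in> carrier M"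
  have "a \<odot>\<^bsub>M\<^esub> (b \<odot>\<^bsub>M\<^esub> x) \<in> ideal_smult R M (J \<cdot> K)" if "a \<in> J" for a
    using smult_in_ideal_smult[OF ideal_prod.prod[of _ J _ K R, OF that bx(1)] bx(2)] bx that
      ideal.Icarr[OF J] ideal.Icarr[OF K] by (simp add: smult_assoc1)
  then show "b \<odot>\<^bsub>M\<^esub> x \<in> module_colon M (ideal_smult R M (J \<cdot> K)) J"
    using bx ideal.Icarr[OF K] by (simp add: module_colon_def)
qed

end


section \<open>The Ratliff-Rush closure of a power\<close>

context module
begin

definition power_colon :: "'a set \<Rightarrow> nat \<Rightarrow> nat \<Rightarrow> 'c set"
  where "power_colon I k t =
    module_colon M (ideal_smult R M (ideal_power R I (k + t))) (ideal_power R I k)"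

lemma power_colon_submodule:
  assumes "ideal I R"
  shows "submodule (power_colon I k t) R M"
  unfolding power_colon_def
  by (intro module_colon_submodule ideal_smult_submodule R.ideal_power_is_ideal assms)

text \<open>Having \<open>I\<^sup>j e\<close> gain \<open>j + t\<close> at the exponent \<open>k\<close> is the same as having \<open>e\<close> gain \<open>t\<close> at the
  exponent \<open>j + k\<close>, as both say \<open>I\<^sup>j\<^sup>+\<^sup>k e \<subseteq> I\<^sup>j\<^sup>+\<^sup>k\<^sup>+\<^sup>t M\<close>.\<close>

lemma power_colon_colon:
  assumes "ideal I R"
  shows "module_colon M (power_colon I k (j + t)) (ideal_power R I j) = power_colon I (j + k) t"
  using assms
  by (simp add: power_colon_def R.ideal_power_add[of I j k] R.ideal_power_is_ideal
      module_colon_ideal_prod ideal_smult_submodule add.left_commute add.assoc)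

text \<open>Multiplying \<open>I\<^sup>k e \<subseteq> I\<^sup>k\<^sup>+\<^sup>t M\<close> by \<open>I\<^sup>j\<close> raises both exponents by \<open>j\<close>.\<close>

lemma power_colon_mono:
  assumes I: "ideal I R" and "k \<le> l"
  shows "power_colon I k t \<subseteq> power_colon I l t"
proof -
  obtain j where l: "l = k + j"
    using \<open>k \<le> l\<close> by (auto simp: le_iff_add)
  note pow = R.ideal_power_is_ideal[OF I]
  let ?N = "ideal_smult R M (ideal_power R I (j + (k + t)))"
  have "ideal_smult R M (ideal_power R I (k + t)) \<subseteq> module_colon M ?N (ideal_power R I j)"
    unfolding R.ideal_power_add[OF I, of j "k + t"] by (rule ideal_smult_subset_colon[OF pow pow])
  then have "power_colon I k t
      \<subseteq> module_colon M (module_colon M ?N (ideal_power R I j)) (ideal_power R I k)"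
    unfolding power_colon_def by (rule module_colon_mono)
  also have "\<dots> = module_colon M ?N (ideal_power R I (k + j))"
    unfolding R.ideal_power_add[OF I, of k j]
    by (rule module_colon_ideal_prod[symmetric, OF ideal_smult_submodule]) (rule pow)+
  also have "\<dots> = power_colon I l t"
    by (simp add: power_colon_def l ac_simps)
  finally show ?thesis .
qed

text \<open>By definition the closure of \<open>I\<^sup>t\<close> is the union of the \<open>C k t\<close> over the multiples \<open>k\<close> of
  \<open>t\<close>. For \<open>t > 0\<close> these are cofinal and \<open>C k t\<close> increases with \<open>k\<close>. For \<open>t = 0\<close> the exponent
  \<open>k = 0\<close> alone gives the whole module.\<close>

lemma ratliff_rush_ideal_power:
  assumes I: "ideal I R"
  shows "ratliff_rush R M (ideal_power R I t) = (\<Union>k. power_colon I k t)"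
proof -
  have "ratliff_rush R M (ideal_power R I t) = (\<Union>k. power_colon I (t * k) t)"
    using I by (simp add: ratliff_rush_def power_colon_def R.ideal_power_power add.commute
        del: Group.nat_pow_Suc)
  also have "\<dots> = (\<Union>k. power_colon I k t)"
  proof
    show "(\<Union>k. power_colon I k t) \<subseteq> (\<Union>k. power_colon I (t * k) t)"
    proof (rule UN_least)
      fix k
      show "power_colon I k t \<subseteq> (\<Union>k. power_colon I (t * k) t)"
      proof (cases "t = 0")
        case True
        have "power_colon I k t \<subseteq> power_colon I (t * 0) t"
          using True smult_in_ideal_smult
          by (auto simp: power_colon_def module_colon_def R.ideal_power_0)
        then show ?thesis by blast
      next
        case False
        then have "power_colon I k t \<subseteq> power_colon I (t * k) t"
          by (intro power_colon_mono I) simp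
        then show ?thesis by blast
      qed
    qed
  qed blast
  finally show ?thesis .
qed

text \<open>Finitely many generators of \<open>I\<^sup>m\<close> move \<open>e\<close> into finitely many members of an increasing
  chain, hence into a single member.\<close>

lemma colon_ratliff_rush_subset:
  assumes "noetherian_ring R" and I: "ideal I R" and "m \<le> n"
  shows "module_colon M (ratliff_rush R M (ideal_power R I n)) (ideal_power R I m)
    \<subseteq> ratliff_rush R M (ideal_power R I (n - m))"
proof
  fix e
  assume e: "e \<in> module_colon M (ratliff_rush R M (ideal_power R I n)) (ideal_power R I m)"
  obtain A where A: "A \<subseteq> carrier R" "finite A" "ideal_power R I m = Idl A"
    using noetherian_ring.finetely_gen[OF assms(1) R.ideal_power_is_ideal[OF I]] by blast
  have "\<forall>a\<in>A. \<exists>k. a \<odot>\<^bsub>M\<^esub> e \<in> power_colon I k n"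
    using e R.genideal_self[OF A(1)]
    by (auto simp: module_colon_def A(3) ratliff_rush_ideal_power[OF I])
  then obtain f where f: "\<And>a. a \<in> A \<Longrightarrow> a \<odot>\<^bsub>M\<^esub> e \<in> power_colon I (f a) n"
    by metis
  obtain k where k: "\<And>a. a \<in> A \<Longrightarrow> f a \<le> k"
    using finite_nat_set_iff_bounded_le[of "f ` A"] A(2) by auto
  have "e \<in> module_colon M (power_colon I k n) A"
    using e f power_colon_mono[OF I k] by (auto simp: module_colon_def)
  then have "e \<in> module_colon M (power_colon I k (m + (n - m))) (ideal_power R I m)"
    using module_colon_genideal[OF power_colon_submodule[OF I] A(1)] A(3) \<open>m \<le> n\<close> by simp
  then have "e \<in> power_colon I (m + k) (n - m)"
    by (simp add: power_colon_colon[OF I])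
  then show "e \<in> ratliff_rush R M (ideal_power R I (n - m))"
    by (auto simp: ratliff_rush_ideal_power[OF I])
qed

end


section \<open>The closure in the ring and its action on the closure in the module\<close>

context cring
begin

lemma ideal_smult_regular_module:
  assumes J: "ideal J R"
  shows "ideal_smult R (regular_module R) J = J"
proof
  interpret reg: module R "regular_module R"
    by (rule regular_module_is_module)
  show "J \<subseteq> ideal_smult R (regular_module R) J"
    using reg.smult_in_ideal_smult[of _ J \<one>] ideal.Icarr[OF J]
    by (auto simp: regular_module_def)
  have neg: "\<ominus>\<^bsub>regular_module R\<^esub> a = \<ominus> a" for a
    by (simp add: regular_module_def a_inv_def m_inv_def)
  have "submodule J R (regular_module R)"
    using ideal.Icarr[OF J] additive_subgroup.zero_closed[OF ideal.axioms(1)[OF J]]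
      additive_subgroup.a_closed[OF ideal.axioms(1)[OF J]]
      additive_subgroup.a_inv_closed[OF ideal.axioms(1)[OF J]] ideal.I_l_closed[OF J]
    by (intro reg.submoduleI) (auto simp: neg, auto simp: regular_module_def)
  then show "ideal_smult R (regular_module R) J \<subseteq> J"
    by (rule reg.ideal_smult_minimal) (auto simp: regular_module_def intro: ideal.I_r_closed[OF J])
qed

lemma ratliff_rush_ideal_power_iff:
  assumes I: "ideal I R"
  shows "a \<in> ratliff_rush_ideal R (ideal_power R I m) \<longleftrightarrow>
    a \<in> carrier R \<and> (\<exists>l. \<forall>x\<in>ideal_power R I l. x \<otimes> a \<in> ideal_power R I (l + m))"
proof -
  interpret reg: module R "regular_module R"
    by (rule regular_module_is_module)
  show ?thesis
    unfolding ratliff_rush_ideal_def reg.ratliff_rush_ideal_power[OF I] reg.power_colon_def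
      ideal_smult_regular_module[OF ideal_power_is_ideal[OF I]]
    by (auto simp: module_colon_def regular_module_def)
qed

lemma ideal_power_subset_ratliff_rush_ideal:
  assumes I: "ideal I R"
  shows "ideal_power R I m \<subseteq> ratliff_rush_ideal R (ideal_power R I m)"
proof
  fix a assume a: "a \<in> ideal_power R I m"
  note pow = ideal_power_is_ideal[OF I, of m]
  have "\<forall>x\<in>ideal_power R I 0. x \<otimes> a \<in> ideal_power R I (0 + m)"
    using ideal.I_l_closed[OF pow a] by (simp only: ideal_power_0 add_0) blast
  then show "a \<in> ratliff_rush_ideal R (ideal_power R I m)"
    using ideal.Icarr[OF pow a] ratliff_rush_ideal_power_iff[OF I] by blast
qed

end

text \<open>Gains add up: if \<open>I\<^sup>l a \<subseteq> I\<^sup>l\<^sup>+\<^sup>m\<close> and \<open>I\<^sup>k e \<subseteq> I\<^sup>k\<^sup>+\<^sup>t M\<close>, then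
  \<open>I\<^sup>l\<^sup>+\<^sup>k a e \<subseteq> (I\<^sup>l a) (I\<^sup>k e) \<subseteq> I\<^sup>l\<^sup>+\<^sup>k\<^sup>+\<^sup>m\<^sup>+\<^sup>t M\<close>.\<close>

lemma (in module) ratliff_rush_smult:
  assumes I: "ideal I R"
    and a: "a \<in> ratliff_rush_ideal R (ideal_power R I m)"
    and e: "e \<in> ratliff_rush R M (ideal_power R I t)"
  shows "a \<odot>\<^bsub>M\<^esub> e \<in> ratliff_rush R M (ideal_power R I (m + t))"
proof -
  note pow = R.ideal_power_is_ideal[OF I]
  obtain l where aR: "a \<in> carrier R"
    and l: "\<And>x. x \<in> ideal_power R I l \<Longrightarrow> x \<otimes> a \<in> ideal_power R I (l + m)"
    using a R.ratliff_rush_ideal_power_iff[OF I] by blast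
  obtain k where "e \<in> power_colon I k t"
    using e by (auto simp: ratliff_rush_ideal_power[OF I])
  then have eM: "e \<in> carrier M"
    and k: "\<And>y. y \<in> ideal_power R I k \<Longrightarrow> y \<odot>\<^bsub>M\<^esub> e \<in> ideal_smult R M (ideal_power R I (k + t))"
    by (auto simp: power_colon_def module_colon_def)
  have "x \<odot>\<^bsub>M\<^esub> (a \<odot>\<^bsub>M\<^esub> e) \<in> power_colon I k (l + (m + t))" if x: "x \<in> ideal_power R I l" for x
  proof -
    have xR: "x \<in> carrier R"
      using ideal.Icarr[OF pow x] .
    have "y \<odot>\<^bsub>M\<^esub> (x \<odot>\<^bsub>M\<^esub> (a \<odot>\<^bsub>M\<^esub> e)) \<in> ideal_smult R M (ideal_power R I (k + (l + (m + t))))"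
      if y: "y \<in> ideal_power R I k" for y
    proof -
      have "(x \<otimes> a) \<odot>\<^bsub>M\<^esub> (y \<odot>\<^bsub>M\<^esub> e) \<in> ideal_smult R M (ideal_power R I ((l + m) + (k + t)))"
        using ideal_smult_subset_colon[OF pow pow] k[OF y] l[OF x]
        unfolding R.ideal_power_add[OF I, of "l + m" "k + t"] module_colon_def by blast
      moreover have "(x \<otimes> a) \<odot>\<^bsub>M\<^esub> (y \<odot>\<^bsub>M\<^esub> e) = y \<odot>\<^bsub>M\<^esub> (x \<odot>\<^bsub>M\<^esub> (a \<odot>\<^bsub>M\<^esub> e))"
        using xR aR eM ideal.Icarr[OF pow y]
        by (metis R.m_closed R.m_comm smult_assoc1)
      ultimately show ?thesis
        by (simp add: ac_simps)
    qed
    then show ?thesis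
      using xR aR eM by (simp add: power_colon_def module_colon_def)
  qed
  then have "a \<odot>\<^bsub>M\<^esub> e \<in> module_colon M (power_colon I k (l + (m + t))) (ideal_power R I l)"
    using aR eM by (simp add: module_colon_def)
  then show ?thesis
    by (auto simp: power_colon_colon[OF I] ratliff_rush_ideal_power[OF I])
qed


section \<open>Colons of Ratliff-Rush closures of powers\<close>

theorem lemma1p3:
  fixes R :: "('a, 'c) ring_scheme"
    and E :: "('a, 'b, 'd) module_scheme"
    and I :: "'a set"
    and m n :: nat
  assumes "cring R" and "noetherian_ring R" and "\<one>\<^bsub>R\<^esub> \<noteq> \<zero>\<^bsub>R\<^esub>"
    and "ideal I R"
    and "module R E" and "fin_gen_module R E" and "carrier E \<noteq> {\<zero>\<^bsub>E\<^esub>}"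
    and "n \<ge> m"
  shows "module_colon E (ratliff_rush R E (ideal_power R I n))
             (ratliff_rush_ideal R (ideal_power R I m))
           = module_colon E (ratliff_rush R E (ideal_power R I n)) (ideal_power R I m)
       \<and> module_colon E (ratliff_rush R E (ideal_power R I n)) (ideal_power R I m)
           = ratliff_rush R E (ideal_power R I (n - m))"
proof -
  interpret module R E by fact
  let ?RR = "\<lambda>t. ratliff_rush R E (ideal_power R I t)"
  let ?J = "ratliff_rush_ideal R (ideal_power R I m)"
  have "?RR (n - m) \<subseteq> module_colon E (?RR n) ?J"
  proof
    fix e assume e: "e \<in> ?RR (n - m)"
    then have "e \<in> carrier E"
      by (auto simp: ratliff_rush_def module_colon_def)
    then show "e \<in> module_colon E (?RR n) ?J"
      using ratliff_rush_smult[OF \<open>ideal I R\<close> _ e, of _ m] \<open>n \<ge> m\<close>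
      by (auto simp: module_colon_def)
  qed
  moreover have "module_colon E (?RR n) ?J \<subseteq> module_colon E (?RR n) (ideal_power R I m)"
    using R.ideal_power_subset_ratliff_rush_ideal[OF \<open>ideal I R\<close>]
    by (auto simp: module_colon_def)
  moreover have "module_colon E (?RR n) (ideal_power R I m) \<subseteq> ?RR (n - m)"
    by (rule colon_ratliff_rush_subset) fact+
  ultimately show ?thesis
    by blast
qed

end
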